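(* Let $n_1,\ldots,n_M\ge1$ be integers, $k\in[M]$, and integers $L_P$ with $1\le L_P\le\prod_{i\in P}n_i$ for $P\in\binom{[M]}{k}$. For each $P$ let $K_P=\prod_{i\in P}n_i$, $N_P=\mathrm{lcm}\{n_i:i\in P\}$ and $\ell_P=K_P/N_P$. Suppose $\mu>0$ satisfies $\ell_P\lceil\mu N_P\rceil\le L_P$ for all $P\in\binom{[M]}{k}$. Then for every $0\le\beta\le1-\mu$, $\mathbb{C}(n_1,\ldots,n_M;\beta,\mu)$ is a $k$-dimensional transversal with parameters $\{L_P\}$. Moreover, if $\mu=\min_{P}L_P/K_P$, then it is a full transversal.
   Context: $[n]^{\star}=\{0,\ldots,n-1\}$, $\pi_M=\prod_{i=1}^M[n_i]^{\star}$, $\{x\}=x-\lfloor x\rfloor$. $\mathbb{C}(n_1,\ldots,n_M;\beta,\mu)=\{(i_1,\ldots,i_M)\in\pi_M:\{\sum_{j=1}^M i_j/n_j\}\in[\beta,\beta+\mu)\}$. A $k$-dimensional transversal on $\pi_M$ with parameters $\{L_P\}$ is a set $\mathcal{T}\subseteq\pi_M$ such that for every $P\in\binom{[M]}{k}$ and every choice of $b_j\in[n_j]^{\star}$ ($j\notin P$), at most $L_P$ elements of $\mathcal{T}$ have $j$-th coordinate $b_j$ for all $j\notin P$; it is full if $|\mathcal{T}|=L_P\prod_{j\notin P}n_j$ for at least one $P$. *)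

theory Defs
  imports "HOL-Analysis.Analysis"
begin

(* Tuples (i_1, ..., i_M) are extensional functions on {1..M}, so that
   distinct tuples are distinct functions and cardinalities are correct. *)
definition index_box :: "nat \<Rightarrow> (nat \<Rightarrow> nat) \<Rightarrow> (nat \<Rightarrow> nat) set" where
  "index_box M n = (\<Pi>\<^sub>E i\<in>{1..M}. {0..<n i})"

definition ksubsets :: "nat \<Rightarrow> nat \<Rightarrow> nat set set" where
  "ksubsets M k = {P. P \<subseteq> {1..M} \<and> card P = k}"

definition frac_slice ::
  "nat \<Rightarrow> (nat \<Rightarrow> nat) \<Rightarrow> real \<Rightarrow> real \<Rightarrow> (nat \<Rightarrow> nat) set" where
  "frac_slice M n \<beta> \<mu> =
     {x \<in> index_box M n. frac (\<Sum>j=1..M. real (x j) / real (n j)) \<in> {\<beta>..<\<beta> + \<mu>}}"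

definition transversal ::
  "nat \<Rightarrow> (nat \<Rightarrow> nat) \<Rightarrow> nat \<Rightarrow> (nat set \<Rightarrow> nat) \<Rightarrow> (nat \<Rightarrow> nat) set \<Rightarrow> bool" where
  "transversal M n k L T \<longleftrightarrow>
     T \<subseteq> index_box M n \<and>
     (\<forall>P\<in>ksubsets M k. \<forall>b. (\<forall>j\<in>{1..M} - P. b j < n j) \<longrightarrow>
        card {x \<in> T. \<forall>j\<in>{1..M} - P. x j = b j} \<le> L P)"

definition full_transversal ::
  "nat \<Rightarrow> (nat \<Rightarrow> nat) \<Rightarrow> nat \<Rightarrow> (nat set \<Rightarrow> nat) \<Rightarrow> (nat \<Rightarrow> nat) set \<Rightarrow> bool" where
  "full_transversal M n k L T \<longleftrightarrow>
     transversal M n k L T \<and>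
     (\<exists>P\<in>ksubsets M k. card T = L P * (\<Prod>j\<in>{1..M} - P. n j))"

definition K_of :: "(nat \<Rightarrow> nat) \<Rightarrow> nat set \<Rightarrow> nat" where
  "K_of n P = (\<Prod>i\<in>P. n i)"

definition N_of :: "(nat \<Rightarrow> nat) \<Rightarrow> nat set \<Rightarrow> nat" where
  "N_of n P = (LCM i\<in>P. n i)"

lemma N_of_dvd_K_of: "finite P \<Longrightarrow> N_of n P dvd K_of n P"
  unfolding N_of_def K_of_def by (rule Lcm_least) auto

(* The division is exact for finite P, by N_of_dvd_K_of. *)
definition ell_of :: "(nat \<Rightarrow> nat) \<Rightarrow> nat set \<Rightarrow> nat" where
  "ell_of n P = K_of n P div N_of n P"

end

theory Submission
  imports Defs
begin

text \<open>
  Fix \<open>P\<close> and the coordinates outside \<open>P\<close>, contributing a constant \<open>c\<close> to the sum. The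
  homomorphism \<open>x \<mapsto> \<Sum>i\<in>P. x i / n i\<close> from the product of the cyclic groups of order \<open>n i\<close> to
  \<open>\<real>/\<int>\<close> has image generated by \<open>1/N\<close> (Bezout), so all its fibres over multiples
  of \<open>1/N\<close> have the same size \<open>K/N\<close>. Hence the slice has \<open>K/N\<close> times as many points as there are
  integers \<open>q\<close> with \<open>c + q/N \<in> [\<beta>, \<beta> + \<mu>)\<close>: at most \<open>\<lceil>\<mu>N\<rceil>\<close>, and exactly \<open>\<mu>N\<close> if
  that is an integer. For the minimising \<open>P\<close> the hypothesis forces \<open>\<mu>N\<close> to be an integer.
\<close>

text \<open>For \<open>v\<close> \<ge> 0 the left side counts the integers in [u, u + v), so this
  caps the count wherever the interval starts.\<close>

lemma ceiling_add_diff_le: "\<lceil>u + v\<rceil> - \<lceil>u\<rceil> \<le> \<lceil>v\<rceil>" for u v :: real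
  using ceiling_add_le[of u v] by linarith

section \<open>The subgroup of \<real>/\<int> generated by unit fractions\<close>

lemma N_of_pos: "finite P \<Longrightarrow> (\<And>i. i \<in> P \<Longrightarrow> 0 < n i) \<Longrightarrow> 0 < N_of n P"
  unfolding N_of_def by (induction P rule: finite_induct) (auto simp: lcm_pos_nat)

text \<open>Induction on \<open>P\<close>: dividing a Bezout identity for \<open>n j\<close> and
  \<open>N_of n P\<close> by their product gives gcd / product = 1 / lcm. The integer
  \<open>w\<close> absorbs the empty case, where the sum is 0 but \<open>N_of n {}\<close> is
  1.\<close>

lemma bezout_unit_fractions:
  assumes "finite P" "\<And>i. i \<in> P \<Longrightarrow> 0 < n i"
  shows "\<exists>(z::nat \<Rightarrow> int) (w::int). (\<Sum>i\<in>P. z i / n i) + w = 1 / N_of n P"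
  using assms
proof (induction P rule: finite_induct)
  case empty
  show ?case by (auto simp: N_of_def intro: exI[of _ 1])
next
  case (insert j P)
  then obtain z :: "nat \<Rightarrow> int" and w :: int
    where zw: "(\<Sum>i\<in>P. z i / n i) + w = 1 / N_of n P" by auto
  have pos: "0 < n j" "0 < N_of n P" using insert by (auto intro: N_of_pos)
  obtain u v where uv: "u * int (n j) + v * int (N_of n P) = gcd (int (n j)) (int (N_of n P))"
    using bezout_int by blast
  have N: "N_of n (insert j P) = lcm (n j) (N_of n P)"
    by (simp add: N_of_def)
  have prod: "real (gcd (n j) (N_of n P)) * real (lcm (n j) (N_of n P)) = real (n j) * real (N_of n P)"
    by (metis of_nat_mult prod_gcd_lcm_nat)
  have lcm_pos: "0 < lcm (n j) (N_of n P)" using pos by (simp add: lcm_pos_nat)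
  have "real_of_int (u * int (n j) + v * int (N_of n P)) = real (gcd (n j) (N_of n P))"
    unfolding uv by simp
  then have uv': "real_of_int u * n j + v * N_of n P = gcd (n j) (N_of n P)"
    by simp
  have "real_of_int u / N_of n P + v / n j = (u * n j + v * N_of n P) / (real (n j) * N_of n P)"
    using pos by (simp add: field_simps)
  also have "\<dots> = 1 / N_of n (insert j P)"
    unfolding prod[symmetric] N using uv' pos by simp
  finally have key: "real_of_int u / N_of n P + v / n j = 1 / N_of n (insert j P)" .
  \<comment> \<open>Scaling the induction hypothesis by \<open>u\<close> expresses
    \<open>u / N_of n P\<close> through \<open>P\<close>; the new index receives the other Bezout
    coefficient \<open>v\<close>.\<close>
  define z' where "z' = (\<lambda>i. if i = j then v else u * z i)"
  have "(\<Sum>i\<in>P. z' i / n i) = (\<Sum>i\<in>P. u * (z i / n i))"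
    using insert.hyps by (intro sum.cong) (auto simp: z'_def)
  then have "(\<Sum>i\<in>insert j P. z' i / n i) + (u * w) = v / n j + u * ((\<Sum>i\<in>P. z i / n i) + w)"
    using insert.hyps by (simp add: z'_def sum_distrib_left algebra_simps)
  also have "\<dots> = 1 / N_of n (insert j P)"
    unfolding zw using key by simp
  finally show ?case by (metis of_int_mult)
qed

text \<open>Converse of \<open>bezout_unit_fractions\<close>: sums of the fractions are always
  multiples of \<open>1 / N_of n P\<close>.\<close>

lemma N_of_mult_sum_Ints:
  fixes x :: "nat \<Rightarrow> nat"
  assumes "finite P" "\<And>i. i \<in> P \<Longrightarrow> 0 < n i"
  shows "N_of n P * (\<Sum>i\<in>P. x i / n i) \<in> \<int>"
proof -
  have "real (N_of n P) * (x i / n i) \<in> \<int>" if "i \<in> P" for i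
  proof -
    have "n i dvd N_of n P" using that by (simp add: N_of_def dvd_Lcm)
    then obtain q where "N_of n P = n i * q" ..
    then have "real (N_of n P) * (x i / n i) = of_nat (q * x i)"
      using assms(2)[OF that] by simp
    then show ?thesis by (metis Ints_of_nat)
  qed
  then show ?thesis by (simp add: sum_distrib_left Ints_sum)
qed

section \<open>Fibres of the sum map modulo 1\<close>

definition sum_fibre :: "nat set \<Rightarrow> (nat \<Rightarrow> nat) \<Rightarrow> real \<Rightarrow> (nat \<Rightarrow> nat) set" where
  "sum_fibre P n r = {x \<in> (\<Pi>\<^sub>E i\<in>P. {0..<n i}). (\<Sum>i\<in>P. x i / n i) - r \<in> \<int>}"

lemma finite_sum_fibre: "finite P \<Longrightarrow> finite (sum_fibre P n r)"
  unfolding sum_fibre_def by (rule finite_subset[of _ "\<Pi>\<^sub>E i\<in>P. {0..<n i}"]) (auto intro: finite_PiE)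

text \<open>Translation by \<open>z\<close>, reduced modulo \<open>n i\<close> in each coordinate,
  is injective and carries the fibre over \<open>r\<close> into the fibre over \<open>r'\<close>. An
  inequality suffices, since the opposite translation gives the other one.\<close>

lemma card_sum_fibre_shift_le:
  fixes z :: "nat \<Rightarrow> int"
  assumes "finite P" and pos: "\<And>i. i \<in> P \<Longrightarrow> 0 < n i"
    and r': "r + (\<Sum>i\<in>P. z i / n i) - r' \<in> \<int>"
  shows "card (sum_fibre P n r) \<le> card (sum_fibre P n r')"
proof -
  define f where "f = (\<lambda>x. \<lambda>i\<in>P. nat ((int (x i) + z i) mod int (n i)))"
  have f_val: "int (f x i) = (int (x i) + z i) mod int (n i)" if "i \<in> P" for x i
    using that pos[OF that] by (simp add: f_def)
  have "inj_on f (sum_fibre P n r)"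
  proof (rule inj_onI)
    fix x y assume x: "x \<in> sum_fibre P n r" and y: "y \<in> sum_fibre P n r" and eq: "f x = f y"
    have "x i = y i" if "i \<in> P" for i
    proof -
      have "(int (x i) + z i) mod int (n i) = (int (y i) + z i) mod int (n i)"
        using f_val[OF that] eq by metis
      then have "int (x i) mod int (n i) = int (y i) mod int (n i)"
        by (metis add_diff_cancel_right' mod_diff_left_eq)
      moreover have "x i < n i" "y i < n i"
        using x y that by (auto simp: sum_fibre_def PiE_def Pi_def)
      ultimately show ?thesis by simp
    qed
    then show "x = y"
      using x y by (auto simp: sum_fibre_def intro: PiE_ext)
  qed
  moreover have "f x \<in> sum_fibre P n r'" if x: "x \<in> sum_fibre P n r" for x
  proof -
    have box: "f x \<in> (\<Pi>\<^sub>E i\<in>P. {0..<n i})"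
      using pos by (auto simp: f_def nat_less_iff)
    \<comment> \<open>Reduction modulo \<open>n i\<close> changes the fraction only by the integer
      quotient, which is invisible modulo 1.\<close>
    have "real (f x i) / n i = (x i / n i + z i / n i) - ((int (x i) + z i) div int (n i))"
      if "i \<in> P" for i
    proof -
      have "int (x i) + z i = int (f x i) + int (n i) * ((int (x i) + z i) div int (n i))"
        using f_val[OF that] by simp
      then have "real_of_int (int (x i) + z i)
          = real_of_int (int (f x i) + int (n i) * ((int (x i) + z i) div int (n i)))" by simp
      then have "real (x i) + z i = f x i + n i * ((int (x i) + z i) div int (n i))"
        by simp
      then show ?thesis using pos[OF that] by (simp add: field_simps)
    qed
    then have "(\<Sum>i\<in>P. f x i / n i) - r' = ((\<Sum>i\<in>P. x i / n i) - r)
        + (r + (\<Sum>i\<in>P. z i / n i) - r') - (\<Sum>i\<in>P. ((int (x i) + z i) div int (n i)))"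
      by (simp only: sum_subtractf sum.distrib of_int_sum cong: sum.cong)
    moreover have "(\<Sum>i\<in>P. x i / n i) - r \<in> \<int>" using x by (simp add: sum_fibre_def)
    ultimately have "(\<Sum>i\<in>P. f x i / n i) - r' \<in> \<int>"
      using r' by (simp only: Ints_add Ints_diff Ints_of_int)
    with box show ?thesis by (simp add: sum_fibre_def)
  qed
  ultimately show ?thesis
    using finite_sum_fibre[OF assms(1)] by (intro card_inj_on_le[of f]) auto
qed

text \<open>The Bezout coefficients shift the sum by \<open>1 / N_of n P\<close> modulo 1, so
  \<open>b - a\<close> times them shifts it from \<open>a / N_of n P\<close> to
  \<open>b / N_of n P\<close>.\<close>

lemma card_sum_fibre_eq:
  fixes a b :: int
  assumes "finite P" and pos: "\<And>i. i \<in> P \<Longrightarrow> 0 < n i"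
  shows "card (sum_fibre P n (a / N_of n P)) = card (sum_fibre P n (b / N_of n P))"
proof -
  obtain z :: "nat \<Rightarrow> int" and w :: int
    where zw: "(\<Sum>i\<in>P. z i / n i) + w = 1 / N_of n P"
    using bezout_unit_fractions[of P n] assms by blast
  have le: "card (sum_fibre P n (a / N_of n P)) \<le> card (sum_fibre P n (b / N_of n P))" for a b :: int
  proof (rule card_sum_fibre_shift_le[where z = "\<lambda>i. (b - a) * z i"])
    have "(\<Sum>i\<in>P. real_of_int ((b - a) * z i) / n i) = (b - a) * (1 / N_of n P - w)"
      by (simp add: zw[symmetric] sum_distrib_left)
    then have "a / N_of n P + (\<Sum>i\<in>P. real_of_int ((b - a) * z i) / n i) - b / N_of n P
        = of_int (- (b - a) * w)"
      by (simp add: algebra_simps diff_divide_distrib)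
    then show "a / N_of n P + (\<Sum>i\<in>P. real_of_int ((b - a) * z i) / n i) - b / N_of n P \<in> \<int>"
      by (metis Ints_of_int)
  qed (use assms in auto)
  show ?thesis by (intro antisym le)
qed

section \<open>Counting points whose fractional part lies in an interval\<close>

text \<open>The set is a disjoint union of equally large fibres over \<open>q / N_of n P\<close>,
  one for each integer \<open>q\<close> in [u, u + \<mu>N).\<close>

lemma card_frac_sum_sum_fibre:
  fixes c \<beta> \<mu> :: real
  assumes fin: "finite P" and pos: "\<And>i. i \<in> P \<Longrightarrow> 0 < n i"
    and \<beta>: "0 \<le> \<beta>" "\<beta> + \<mu> \<le> 1" and \<mu>: "0 \<le> \<mu>"
  defines "u \<equiv> N_of n P * (\<beta> - c)"
  shows "int (card {x \<in> (\<Pi>\<^sub>E i\<in>P. {0..<n i}). frac (c + (\<Sum>i\<in>P. real (x i) / n i)) \<in> {\<beta>..<\<beta> + \<mu>}})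
    = int (card (sum_fibre P n 0)) * (\<lceil>u + \<mu> * N_of n P\<rceil> - \<lceil>u\<rceil>)"
    (is "int (card ?A) = _")
proof -
  let ?N = "N_of n P"
  let ?S = "{\<lceil>u\<rceil>..<\<lceil>u + \<mu> * ?N\<rceil>}"
  have N: "0 < ?N" using fin pos by (rule N_of_pos)
  have S_iff: "q \<in> ?S \<longleftrightarrow> c + q / ?N \<in> {\<beta>..<\<beta> + \<mu>}" for q :: int
    using N by (auto simp: u_def ceiling_le_iff less_ceiling_iff field_simps)
  have "?A = (\<Union>q\<in>?S. sum_fibre P n (real_of_int q / ?N))"
  proof (intro equalityI subsetI)
    fix x assume x: "x \<in> ?A"
    let ?s = "\<Sum>i\<in>P. x i / n i"
    obtain a :: int where a: "?N * ?s = a"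
      using N_of_mult_sum_Ints[of P n x, OF fin pos] by (auto elim: Ints_cases)
    \<comment> \<open>Subtracting the floor makes \<open>c + q / ?N\<close> the fractional part
      itself.\<close>
    define q where "q = a - ?N * \<lfloor>c + ?s\<rfloor>"
    have q: "q / ?N = ?s - \<lfloor>c + ?s\<rfloor>"
      using N by (simp add: q_def a[symmetric] field_simps)
    have "q \<in> ?S"
      using x unfolding S_iff by (simp add: q frac_def algebra_simps)
    moreover have "x \<in> sum_fibre P n (real_of_int q / ?N)"
      using x by (simp add: sum_fibre_def q)
    ultimately show "x \<in> (\<Union>q\<in>?S. sum_fibre P n (real_of_int q / ?N))" by blast
  next
    fix x assume "x \<in> (\<Union>q\<in>?S. sum_fibre P n (real_of_int q / ?N))"
    then obtain q :: int where q: "q \<in> ?S" "x \<in> sum_fibre P n (real_of_int q / ?N)" by blast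
    \<comment> \<open>The bounds on \<beta> and \<mu> place \<open>c + q / ?N\<close> in [0, 1), so
      it is its own fractional part.\<close>
    have "frac (c + (\<Sum>i\<in>P. x i / n i)) = c + q / ?N"
      using q \<beta> unfolding frac_unique_iff S_iff sum_fibre_def by auto
    with q show "x \<in> ?A" unfolding S_iff sum_fibre_def by simp
  qed
  moreover have "card (\<Union>q\<in>?S. sum_fibre P n (real_of_int q / ?N)) = (\<Sum>q\<in>?S. card (sum_fibre P n (real_of_int q / ?N)))"
  proof (rule card_UN_disjoint)
    have "q = q'" if q: "q \<in> ?S" "x \<in> sum_fibre P n (real_of_int q / ?N)"
      and q': "q' \<in> ?S" "x \<in> sum_fibre P n (real_of_int q' / ?N)" for q q' :: int and x
    proof -
      \<comment> \<open>A common point makes the difference an integer, while both values lie in one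
        half-open interval of length at most 1.\<close>
      have "real_of_int q / ?N - q' / ?N \<in> \<int>"
        using Ints_diff[of "(\<Sum>i\<in>P. x i / n i) - q' / ?N" "(\<Sum>i\<in>P. x i / n i) - q / ?N"] q q'
        by (simp add: sum_fibre_def)
      moreover have "\<bar>q / ?N - q' / ?N\<bar> < 1"
        using q(1) q'(1) \<beta> unfolding S_iff by auto
      ultimately have "real_of_int q / ?N - q' / ?N = 0"
        by (metis Ints_nonzero_abs_less1)
      then show "q = q'" using N by simp
    qed
    then show "\<forall>q\<in>?S. \<forall>q'\<in>?S. q \<noteq> q' \<longrightarrow> sum_fibre P n (real_of_int q / ?N) \<inter> sum_fibre P n (real_of_int q' / ?N) = {}"
      by blast
  qed (auto simp: finite_sum_fibre fin)
  moreover have "card (sum_fibre P n (real_of_int q / ?N)) = card (sum_fibre P n 0)" for q :: int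
    using card_sum_fibre_eq[of P n q 0, OF fin pos] by simp
  moreover have "\<lceil>u\<rceil> \<le> \<lceil>u + \<mu> * ?N\<rceil>"
    using \<mu> by (intro ceiling_mono) simp
  ultimately show ?thesis by simp
qed

text \<open>With \<beta> = 0 and \<mu> = 1 the counted set is the whole box, and exactly
  \<open>N_of n P\<close> integers \<open>q\<close> occur.\<close>

lemma K_of_eq_card_sum_fibre_N_of:
  assumes "finite P" "\<And>i. i \<in> P \<Longrightarrow> 0 < n i"
  shows "K_of n P = card (sum_fibre P n 0) * N_of n P"
proof -
  have "int (card (\<Pi>\<^sub>E i\<in>P. {0..<n i})) = int (card (sum_fibre P n 0)) * int (N_of n P)"
    using card_frac_sum_sum_fibre[where P = P and n = n and c = 0 and \<beta> = 0 and \<mu> = 1] assms by (simp add: frac_lt_1)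
  moreover have "card (\<Pi>\<^sub>E i\<in>P. {0..<n i}) = K_of n P"
    using assms by (simp add: K_of_def card_PiE)
  ultimately show ?thesis by (metis of_nat_eq_iff of_nat_mult)
qed

lemma ell_of_eq_card_sum_fibre:
  assumes "finite P" "\<And>i. i \<in> P \<Longrightarrow> 0 < n i"
  shows "ell_of n P = card (sum_fibre P n 0)"
  using N_of_pos[of P n, OF assms] K_of_eq_card_sum_fibre_N_of[of P n, OF assms]
  by (simp add: ell_of_def)

section \<open>Slices with the coordinates outside \<open>P\<close> prescribed\<close>

text \<open>Restriction to \<open>P\<close> is a bijection onto the set counted before, with the
  prescribed coordinates contributing the constant \<open>c\<close>. The value of \<open>u\<close>
  depends on \<open>b\<close>, but its later uses hold for any real \<open>u\<close>.\<close>

lemma card_frac_slice_fibre: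
  assumes pos: "\<And>i. i \<in> {1..M} \<Longrightarrow> 0 < n i" and P: "P \<subseteq> {1..M}"
    and b: "\<And>j. j \<in> {1..M} - P \<Longrightarrow> b j < n j"
    and \<beta>: "0 \<le> \<beta>" "\<beta> + \<mu> \<le> 1" and \<mu>: "0 \<le> \<mu>"
  obtains u :: real where
    "int (card {x \<in> frac_slice M n \<beta> \<mu>. \<forall>j\<in>{1..M} - P. x j = b j})
      = int (ell_of n P) * (\<lceil>u + \<mu> * N_of n P\<rceil> - \<lceil>u\<rceil>)"
proof -
  define c where "c = (\<Sum>j\<in>{1..M} - P. b j / n j)"
  have fin: "finite P" using P by (rule finite_subset) simp
  have posP: "0 < n i" if "i \<in> P" for i using that P pos by blast
  let ?A = "{x \<in> frac_slice M n \<beta> \<mu>. \<forall>j\<in>{1..M} - P. x j = b j}"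
  let ?B = "{x \<in> (\<Pi>\<^sub>E i\<in>P. {0..<n i}). frac (c + (\<Sum>i\<in>P. real (x i) / n i)) \<in> {\<beta>..<\<beta> + \<mu>}}"
  \<comment> \<open>The inverse of restriction; the value \<open>undefined\<close> keeps the tuple
    extensional on \<open>{1..M}\<close>.\<close>
  let ?ext = "\<lambda>y j. if j \<in> P then y j else if j \<in> {1..M} then b j else undefined"
  have split: "(\<Sum>j=1..M. x j / n j) = c + (\<Sum>i\<in>P. x i / n i)"
    if "\<forall>j\<in>{1..M} - P. x j = b j" for x :: "nat \<Rightarrow> nat"
  proof -
    have "(\<Sum>j=1..M. x j / n j) = (\<Sum>j\<in>{1..M} - P. x j / n j) + (\<Sum>i\<in>P. x i / n i)"
      using P by (intro sum.subset_diff) auto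
    with that show ?thesis by (simp add: c_def)
  qed
  have "bij_betw (\<lambda>x. restrict x P) ?A ?B"
  proof (rule bij_betw_byWitness[where f' = ?ext])
    show "\<forall>x\<in>?A. ?ext (restrict x P) = x"
      using P by (auto simp: frac_slice_def index_box_def PiE_def extensional_def fun_eq_iff)
    show "\<forall>y\<in>?B. restrict (?ext y) P = y"
      by (auto simp: PiE_def extensional_def fun_eq_iff)
    show "(\<lambda>x. restrict x P) ` ?A \<subseteq> ?B"
    proof (rule image_subsetI)
      fix x assume x: "x \<in> ?A"
      then have "restrict x P \<in> (\<Pi>\<^sub>E i\<in>P. {0..<n i})"
        using P by (auto simp: frac_slice_def index_box_def)
      with x split[of x] show "restrict x P \<in> ?B" by (simp add: frac_slice_def)
    qed
    show "?ext ` ?B \<subseteq> ?A"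
    proof (rule image_subsetI)
      fix y assume y: "y \<in> ?B"
      then have "?ext y \<in> index_box M n"
        using P b by (auto simp: index_box_def PiE_def Pi_def extensional_def)
      with y split[of "?ext y"] show "?ext y \<in> ?A" by (simp add: frac_slice_def)
    qed
  qed
  then have "card ?A = card ?B" by (rule bij_betw_same_card)
  then have "int (card ?A) = int (ell_of n P)
      * (\<lceil>N_of n P * (\<beta> - c) + \<mu> * N_of n P\<rceil> - \<lceil>N_of n P * (\<beta> - c)\<rceil>)"
    using card_frac_sum_sum_fibre[of P n \<beta> \<mu> c, OF fin posP \<beta> \<mu>]
      ell_of_eq_card_sum_fibre[of P n, OF fin posP]
    by simp
  then show thesis by (rule that)
qed

text \<open>\<open>T\<close> is partitioned by the restrictions of its elements to the complement of
  \<open>P\<close>, and the product counts the possible restrictions.\<close>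

lemma card_eq_fibre_mult:
  assumes T: "T \<subseteq> index_box M n"
    and fibre: "\<And>b. (\<forall>j\<in>{1..M} - P. b j < n j) \<Longrightarrow> card {x \<in> T. \<forall>j\<in>{1..M} - P. x j = b j} = l"
  shows "card T = l * (\<Prod>j\<in>{1..M} - P. n j)"
proof -
  let ?Q = "{1..M} - P"
  let ?I = "\<Pi>\<^sub>E j\<in>?Q. {0..<n j}"
  let ?F = "\<lambda>b. {x \<in> T. \<forall>j\<in>?Q. x j = b j}"
  have finT: "finite T"
    using T by (rule finite_subset) (simp add: index_box_def finite_PiE)
  have "T = (\<Union>b\<in>?I. ?F b)"
  proof (intro equalityI subsetI)
    fix x assume x: "x \<in> T"
    then have "restrict x ?Q \<in> ?I" using T by (auto simp: index_box_def)
    moreover have "x \<in> ?F (restrict x ?Q)" using x by simp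
    ultimately show "x \<in> (\<Union>b\<in>?I. ?F b)" by blast
  qed blast
  moreover have "card (\<Union>b\<in>?I. ?F b) = (\<Sum>b\<in>?I. card (?F b))"
  proof (rule card_UN_disjoint)
    show "\<forall>b\<in>?I. \<forall>b'\<in>?I. b \<noteq> b' \<longrightarrow> ?F b \<inter> ?F b' = {}"
    proof (intro ballI impI, rule ccontr)
      fix b b' assume I: "b \<in> ?I" "b' \<in> ?I" and ne: "b \<noteq> b'" and "?F b \<inter> ?F b' \<noteq> {}"
      then have "\<And>j. j \<in> ?Q \<Longrightarrow> b j = b' j" by fastforce
      with I have "b = b'" by (rule PiE_ext)
      with ne show False ..
    qed
  qed (auto simp: finT intro: finite_PiE)
  moreover have "(\<Sum>b\<in>?I. card (?F b)) = (\<Sum>b\<in>?I. l)"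
    by (intro sum.cong refl fibre) (auto simp: PiE_iff)
  moreover have "card ?I = (\<Prod>j\<in>?Q. n j)" by (simp add: card_PiE)
  ultimately show ?thesis by (simp add: mult.commute)
qed

theorem theorem7p5:
  fixes M k :: nat and n :: "nat \<Rightarrow> nat" and L :: "nat set \<Rightarrow> nat" and \<mu> :: real
  assumes n_pos: "\<forall>i\<in>{1..M}. 1 \<le> n i"
    and k_range: "k \<in> {1..M}"
    and L_range: "\<forall>P\<in>ksubsets M k. 1 \<le> L P \<and> L P \<le> K_of n P"
    and mu_pos: "0 < \<mu>"
    and mu_bound: "\<forall>P\<in>ksubsets M k.
      int (ell_of n P) * \<lceil>\<mu> * real (N_of n P)\<rceil> \<le> int (L P)"
  shows "\<forall>\<beta>. 0 \<le> \<beta> \<and> \<beta> \<le> 1 - \<mu> \<longrightarrow>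
      transversal M n k L (frac_slice M n \<beta> \<mu>) \<and>
      (\<mu> = Min ((\<lambda>P. real (L P) / real (K_of n P)) ` ksubsets M k) \<longrightarrow>
        full_transversal M n k L (frac_slice M n \<beta> \<mu>))"
proof (intro allI impI)
  fix \<beta> :: real assume "0 \<le> \<beta> \<and> \<beta> \<le> 1 - \<mu>"
  then have \<beta>: "0 \<le> \<beta>" "\<beta> + \<mu> \<le> 1" by auto
  let ?T = "frac_slice M n \<beta> \<mu>"
  have pos: "0 < n i" if "i \<in> {1..M}" for i using n_pos that by fastforce
  have sub: "?T \<subseteq> index_box M n" by (auto simp: frac_slice_def)
  have "card {x \<in> ?T. \<forall>j\<in>{1..M} - P. x j = b j} \<le> L P"
    if P: "P \<in> ksubsets M k" and b: "\<forall>j\<in>{1..M} - P. b j < n j" for P b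
  proof -
    have "P \<subseteq> {1..M}" using P by (simp add: ksubsets_def)
    then obtain u where u: "int (card {x \<in> ?T. \<forall>j\<in>{1..M} - P. x j = b j})
        = int (ell_of n P) * (\<lceil>u + \<mu> * N_of n P\<rceil> - \<lceil>u\<rceil>)"
      using card_frac_slice_fibre[of M n P b \<beta> \<mu>] pos b \<beta> mu_pos by auto
    also have "\<dots> \<le> int (ell_of n P) * \<lceil>\<mu> * N_of n P\<rceil>"
      by (intro mult_left_mono ceiling_add_diff_le) simp
    also have "\<dots> \<le> int (L P)" using mu_bound P by blast
    finally show ?thesis by simp
  qed
  with sub have trans: "transversal M n k L ?T" unfolding transversal_def by blast
  have "full_transversal M n k L ?T"
    if Min: "\<mu> = Min ((\<lambda>P. real (L P) / real (K_of n P)) ` ksubsets M k)"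
  proof -
    have "finite (ksubsets M k)"
      by (rule finite_subset[of _ "Pow {1..M}"]) (auto simp: ksubsets_def)
    \<comment> \<open>Some \<open>k\<close>-subset exists, so the minimum is attained.\<close>
    moreover have "{1..k} \<in> ksubsets M k" using k_range by (auto simp: ksubsets_def)
    ultimately have "\<mu> \<in> (\<lambda>P. real (L P) / real (K_of n P)) ` ksubsets M k"
      unfolding Min by (intro Min_in) auto
    then obtain P where P: "P \<in> ksubsets M k" and \<mu>: "\<mu> = L P / K_of n P" by auto
    have PM: "P \<subseteq> {1..M}" using P by (simp add: ksubsets_def)
    have fin: "finite P" using PM by (rule finite_subset) simp
    have posP: "0 < n i" if "i \<in> P" for i using that PM pos by blast
    have K: "K_of n P = ell_of n P * N_of n P"
      by (simp add: K_of_eq_card_sum_fibre_N_of ell_of_eq_card_sum_fibre fin posP)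
    have K_pos: "0 < K_of n P" unfolding K_of_def by (intro prod_pos) (auto simp: posP)
    then have ell: "0 < ell_of n P" by (simp add: K)
    have LP: "real (L P) = ell_of n P * (\<mu> * N_of n P)"
      using K_pos by (simp add: \<mu> K)
    \<comment> \<open>At the minimising \<open>P\<close>, \<open>L P\<close> equals
      \<open>ell_of n P\<close> times \<mu>N, so cancelling \<open>ell_of n P\<close> in
      \<open>mu_bound\<close> leaves a ceiling bounded by its own argument: \<mu>N is an
      integer.\<close>
    have "real_of_int (int (ell_of n P) * \<lceil>\<mu> * N_of n P\<rceil>) \<le> real_of_int (int (L P))"
      using mu_bound P by (simp only: of_int_le_iff)
    then have "real_of_int \<lceil>\<mu> * N_of n P\<rceil> \<le> \<mu> * N_of n P"
      using ell by (simp add: LP)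
    then have int: "\<mu> * N_of n P = real_of_int \<lceil>\<mu> * N_of n P\<rceil>" by linarith
    have "card {x \<in> ?T. \<forall>j\<in>{1..M} - P. x j = b j} = L P"
      if b: "\<forall>j\<in>{1..M} - P. b j < n j" for b
    proof -
      obtain u where "int (card {x \<in> ?T. \<forall>j\<in>{1..M} - P. x j = b j})
          = int (ell_of n P) * (\<lceil>u + \<mu> * N_of n P\<rceil> - \<lceil>u\<rceil>)"
        using card_frac_slice_fibre[of M n P b \<beta> \<mu>] PM pos b \<beta> mu_pos by auto
      \<comment> \<open>Adding an integer shifts the ceiling by exactly that integer, so the count
        no longer depends on \<open>u\<close>.\<close>
      also have "\<lceil>u + \<mu> * N_of n P\<rceil> - \<lceil>u\<rceil> = \<lceil>\<mu> * N_of n P\<rceil>"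
        by (subst int) simp
      finally have card: "int (card {x \<in> ?T. \<forall>j\<in>{1..M} - P. x j = b j})
          = int (ell_of n P) * \<lceil>\<mu> * N_of n P\<rceil>" .
      have "real_of_int (int (L P)) = real_of_int (int (ell_of n P) * \<lceil>\<mu> * N_of n P\<rceil>)"
        using int LP by simp
      then have "int (L P) = int (ell_of n P) * \<lceil>\<mu> * N_of n P\<rceil>"
        by (simp only: of_int_eq_iff)
      with card show ?thesis by (simp only: of_nat_eq_iff)
    qed
    then have "card ?T = L P * (\<Prod>j\<in>{1..M} - P. n j)"
      by (intro card_eq_fibre_mult[OF sub])
    with trans P show ?thesis unfolding full_transversal_def by blast
  qed
  with trans show "transversal M n k L ?T \<and>
      (\<mu> = Min ((\<lambda>P. real (L P) / real (K_of n P)) ` ksubsets M k) \<longrightarrow>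
        full_transversal M n k L ?T)" by blast
qed

end
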